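(* Let $\mathbb{L}$ be a (not necessarily commutative) ring with unity. Let $V$ be a finite set and $n=|V|$. For each $s\in V$, let $x_s\in\mathbb{L}$. Let $X,Y\in\mathbb{L}$ be such that $X+Y$ lies in the center of $\mathbb{L}$. Then \[ \sum_{S\subseteq V}\Big(X+\sum_{s\in S}x_s\Big)^{|S|}\Big(Y-\sum_{s\in S}x_s\Big)^{n-|S|}=\sum_{\substack{i_1,i_2,\ldots,i_k\text{ are}\\ \text{distinct elements of }V}}(X+Y)^{n-k}\,x_{i_1}x_{i_2}\cdots x_{i_k}. \]
   Context: The sum on the right-hand side ranges over all nonnegative integers $k$ and all $k$-tuples $(i_1,\ldots,i_k)$ of pairwise distinct elements of $V$; in particular it contains the addend for $k=0$ and the empty tuple, which equals $(X+Y)^n$ (the empty product being $1$). *)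

theory Defs
  imports Main
begin

text \<open>
  A unital, not necessarily commutative ring is a type of sort \<open>{ring, monoid_mult}\<close>. Unlike
  \<open>ring_1\<close>, this sort does not demand \<open>0 \<noteq> 1\<close>, so the zero ring is included.
\<close>

definition ring_center :: "'a::{ring, monoid_mult} set" where
  "ring_center = {z. \<forall>a. z * a = a * z}"

text \<open>
  A tuple of pairwise distinct elements of \<open>V\<close> (of any length, the empty tuple included) is a list
  with \<open>distinct xs\<close> and \<open>set xs \<subseteq> V\<close>. There are only finitely many of them, so a sum over them
  is a genuine sum and does not fall under the convention for infinite index sets.
\<close>

lemma finite_distinct_tuples:
  assumes "finite V"
  shows "finite {xs. distinct xs \<and> set xs \<subseteq> V}"
proof (rule finite_subset)
  show "{xs. distinct xs \<and> set xs \<subseteq> V} \<subseteq> {xs. set xs \<subseteq> V \<and> length xs \<le> card V}"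
    using assms by (auto simp: card_mono simp flip: distinct_card)
  show "finite {xs. set xs \<subseteq> V \<and> length xs \<le> card V}"
    using assms by (rule finite_lists_length_le)
qed

end

theory Submission
  imports Defs "HOL-Combinatorics.Multiset_Permutations"
begin

text \<open>
  Put \<open>Z = X + Y\<close> and \<open>a S = X + (\<Sum>s\<in>S. x s)\<close>, so that the summand on the left is
  \<open>a S ^ card S * (Z - a S) ^ card (V - S)\<close>. As \<open>Z\<close> is central, the second factor expands over
  the subsets \<open>T\<close> of \<open>V - S\<close>. Collecting the terms with \<open>S \<union> T = U\<close> leaves \<open>Z ^ (n - card U)\<close>
  times the alternating sum of \<open>a S ^ card U\<close> over \<open>S \<subseteq> U\<close>. This is a finite difference of order
  \<open>card U\<close> of a power of the same degree, so only the monomials that contain each \<open>x s\<close> with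
  \<open>s \<in> U\<close> exactly once survive (noncommutative polarization).
\<close>

lemma sum_Pow_insert:
  fixes f :: "'v set \<Rightarrow> 'a::comm_monoid_add"
  assumes "finite A" "a \<notin> A"
  shows "(\<Sum>S\<in>Pow (insert a A). f S) = (\<Sum>S\<in>Pow A. f S) + (\<Sum>S\<in>Pow A. f (insert a S))"
proof -
  have "inj_on (insert a) (Pow A)"
    using assms(2) by (auto simp: inj_on_def)
  moreover have "Pow A \<inter> insert a ` Pow A = {}"
    using assms(2) by auto
  ultimately show ?thesis
    using assms(1) by (simp add: Pow_insert sum.union_disjoint sum.reindex)
qed

lemma ring_center_commute: "z \<in> ring_center \<Longrightarrow> z * a = a * z"
  by (simp add: ring_center_def)

lemma ring_center_power:
  assumes "z \<in> ring_center"
  shows "z ^ k \<in> ring_center"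
proof -
  have "z ^ k * a = a * z ^ k" for a
  proof (induction k)
    case (Suc k)
    have "z ^ Suc k * a = z * (a * z ^ k)"
      using Suc by (simp add: mult.assoc)
    also have "\<dots> = a * z ^ Suc k"
      using ring_center_commute[OF assms, of a] by (simp flip: mult.assoc)
    finally show ?case .
  qed simp
  then show ?thesis
    by (simp add: ring_center_def)
qed

lemma power_neg_one_mult_commute:
  fixes a :: "'a::{ring, monoid_mult}"
  shows "(-1) ^ k * a = a * (-1) ^ k"
  by (rule ring_center_commute[OF ring_center_power]) (simp add: ring_center_def)

text \<open>Lets a power of \<open>a\<close> pass a central power and a sign and join another power
  of \<open>a\<close>, with no commutativity between the remaining factors.\<close>

lemma mult_left_commute2:
  fixes a b c d :: "'a::semigroup_mult"
  assumes "b * a = a * b" "c * a = a * c"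
  shows "a * (b * (c * d)) = b * (c * (a * d))"
  using assms by (metis mult.assoc)

text \<open>A subset \<open>T\<close> records which of the \<open>card W\<close> factors contribute
  \<open>- a\<close>. Indexing by subsets instead of binomial coefficients allows \<open>S\<close>
  and \<open>T\<close> to be merged into \<open>S \<union> T\<close> later.\<close>

lemma power_diff_eq_sum_Pow:
  fixes z a :: "'a::{ring, monoid_mult}"
  assumes "finite W" "z \<in> ring_center"
  shows "(z - a) ^ card W = (\<Sum>T\<in>Pow W. z ^ card (W - T) * ((-1) ^ card T * a ^ card T))"
  using assms(1)
proof (induction W rule: finite_induct)
  case (insert w W)
  let ?f = "\<lambda>W T. z ^ card (W - T) * ((-1) ^ card T * a ^ card T)"
  have 1: "?f (insert w W) T = z * ?f W T" if "T \<in> Pow W" for T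
  proof -
    have "insert w W - T = insert w (W - T)"
      using that insert.hyps by auto
    then show ?thesis
      using insert.hyps by (simp add: mult.assoc)
  qed
  have 2: "?f (insert w W) (insert w T) = - (a * ?f W T)" if "T \<in> Pow W" for T
  proof -
    have "insert w W - insert w T = W - T" "w \<notin> T" "finite T"
      using that insert.hyps by (auto dest: finite_subset)
    moreover have "z ^ j * ((-1) ^ k * (a * a ^ k)) = a * (z ^ j * ((-1) ^ k * a ^ k))" for j k
      by (intro mult_left_commute2[symmetric] power_neg_one_mult_commute
          ring_center_commute ring_center_power assms(2))
    ultimately show ?thesis
      by (simp add: mult.assoc)
  qed
  have "(z - a) ^ card (insert w W) = z * sum (?f W) (Pow W) - a * sum (?f W) (Pow W)"
    using insert by (simp add: left_diff_distrib)
  also have "\<dots> = sum (?f (insert w W)) (Pow (insert w W))"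
    using 1 2 insert.hyps by (simp add: sum_Pow_insert sum_distrib_left sum_negf)
  finally show ?case .
qed simp

text \<open>The finite difference of the \<open>m\<close>-th power at \<open>c\<close> in the
  directions \<open>x s\<close>, \<open>s \<in> U\<close>. The base point \<open>c\<close> is a
  parameter because the recursion shifts it, and \<open>m\<close> is independent of
  \<open>card U\<close> because degrees below \<open>card U\<close> also occur.\<close>

definition alternating_power_sum ::
  "('v \<Rightarrow> 'a::{ring, monoid_mult}) \<Rightarrow> 'v set \<Rightarrow> 'a \<Rightarrow> nat \<Rightarrow> 'a" where
  "alternating_power_sum x U c m = (\<Sum>S\<in>Pow U. (-1) ^ card (U - S) * (c + sum x S) ^ m)"

text \<open>For a fixed \<open>u \<in> U\<close>, the terms of \<open>S\<close> and
  \<open>insert u S\<close> have opposite signs and cancel.\<close>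

lemma alternating_power_sum_0:
  assumes "finite U" "U \<noteq> {}"
  shows "alternating_power_sum x U c 0 = 0"
proof -
  obtain u W where U: "U = insert u W" "u \<notin> W" "finite W"
    using assms by (metis all_not_in_conv finite_insert mk_disjoint_insert)
  have 1: "card (insert u W - S) = Suc (card (W - S))" if "S \<in> Pow W" for S
  proof -
    have "insert u W - S = insert u (W - S)"
      using that U by auto
    then show ?thesis
      using U by simp
  qed
  have 2: "insert u W - insert u S = W - S" if "S \<in> Pow W" for S
    using U by auto
  show ?thesis
    using U by (simp add: alternating_power_sum_def sum_Pow_insert 1 2 sum_negf)
qed

text \<open>Split off the leftmost factor \<open>c + sum x S\<close> and group its summands by
  \<open>s\<close>. The sets \<open>S\<close> containing \<open>s\<close> correspond to the subsets
  of \<open>U - {s}\<close>, and \<open>x s\<close> moves into the base point of the remaining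
  power.\<close>

lemma alternating_power_sum_Suc:
  assumes "finite U"
  shows "alternating_power_sum x U c (Suc m) =
    c * alternating_power_sum x U c m +
    (\<Sum>s\<in>U. x s * alternating_power_sum x (U - {s}) (c + x s) m)"
proof -
  let ?g = "\<lambda>S. (-1) ^ card (U - S) * (c + sum x S) ^ m"
  have summand: "(-1) ^ card (U - S) * (c + sum x S) ^ Suc m = c * ?g S + (\<Sum>s\<in>S. x s * ?g S)" for S
  proof -
    have "(-1) ^ card (U - S) * (c + sum x S) ^ Suc m = (c + sum x S) * ?g S"
      by (simp only: power_Suc power_neg_one_mult_commute[of _ "c + sum x S"] flip: mult.assoc)
    then show ?thesis
      by (simp only: distrib_right sum_distrib_right)
  qed
  have inner: "(\<Sum>S\<in>{S \<in> Pow U. s \<in> S}. ?g S) = alternating_power_sum x (U - {s}) (c + x s) m"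
    if "s \<in> U" for s
    unfolding alternating_power_sum_def
  proof (rule sum.reindex_bij_witness[of _ "insert s" "\<lambda>S. S - {s}"])
    fix S assume S: "S \<in> {S \<in> Pow U. s \<in> S}"
    then have "finite S" "U - {s} - (S - {s}) = U - S"
      using assms by (auto dest: finite_subset)
    moreover have "sum x S = x s + sum x (S - {s})"
      using S \<open>finite S\<close> by (simp add: sum.remove)
    ultimately show "(-1) ^ card (U - {s} - (S - {s})) * (c + x s + sum x (S - {s})) ^ m = ?g S"
      by (simp add: add.assoc)
  qed (use that in auto)
  have "(\<Sum>S\<in>Pow U. \<Sum>s\<in>S. x s * ?g S) = (\<Sum>S\<in>Pow U. \<Sum>s\<in>{s \<in> U. s \<in> S}. x s * ?g S)"
    by (intro sum.cong) auto
  also have "\<dots> = (\<Sum>s\<in>U. \<Sum>S\<in>{S \<in> Pow U. s \<in> S}. x s * ?g S)"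
    using assms by (intro sum.swap_restrict) auto
  also have "\<dots> = (\<Sum>s\<in>U. x s * alternating_power_sum x (U - {s}) (c + x s) m)"
    by (intro sum.cong refl) (simp only: inner flip: sum_distrib_left)
  finally show ?thesis
    by (simp only: alternating_power_sum_def[of x U] summand sum.distrib sum_distrib_left)
qed

text \<open>Sorting by the first entry matches the leading factor \<open>x s\<close> in the
  recursion for \<open>alternating_power_sum\<close>.\<close>

lemma sum_permutations_of_set_nonempty:
  assumes "finite U" "U \<noteq> {}"
  shows "(\<Sum>vs\<in>permutations_of_set U. f vs) =
    (\<Sum>s\<in>U. \<Sum>vs\<in>permutations_of_set (U - {s}). f (s # vs))"
proof -
  have "(\<Sum>vs\<in>permutations_of_set U. f vs) =
      (\<Sum>s\<in>U. \<Sum>vs\<in>(#) s ` permutations_of_set (U - {s}). f vs)"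
    using assms by (subst permutations_of_set_nonempty) (auto intro!: sum.UNION_disjoint)
  then show ?thesis
    by (simp add: sum.reindex)
qed

text \<open>In the recursion, the term with factor \<open>c\<close> has degree below
  \<open>card U\<close> and vanishes; the others lower degree and cardinality together. Hence the
  value does not depend on \<open>c\<close>.\<close>

lemma alternating_power_sum_eq:
  assumes "finite U" "m \<le> card U"
  shows "alternating_power_sum x U c m =
    (if m = card U then \<Sum>vs\<in>permutations_of_set U. prod_list (map x vs) else 0)"
  using assms
proof (induction m arbitrary: U c)
  case 0
  then show ?case
    by (cases "U = {}") (simp_all add: alternating_power_sum_0, simp add: alternating_power_sum_def)
next
  case (Suc m)
  then have "U \<noteq> {}"
    by auto
  \<comment> \<open>Here \<open>m < card U\<close>, so the induction hypothesis for the same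
    \<open>U\<close> yields its zero case.\<close>
  have "alternating_power_sum x U c m = 0"
    using Suc by simp
  moreover have "alternating_power_sum x (U - {s}) (c + x s) m =
      (if Suc m = card U then \<Sum>vs\<in>permutations_of_set (U - {s}). prod_list (map x vs) else 0)"
    if "s \<in> U" for s
    using Suc.IH[of "U - {s}"] Suc.prems that by auto
  ultimately show ?case
    using Suc.prems \<open>U \<noteq> {}\<close>
    by (simp add: alternating_power_sum_Suc sum_permutations_of_set_nonempty sum_distrib_left)
qed

theorem theorem2p2:
  fixes V :: "'v set"
    and n :: nat
    and x :: "'v \<Rightarrow> 'a::{ring, monoid_mult}"
    and X Y :: 'a
  assumes "finite V"
    and "n = card V"
    and "X + Y \<in> ring_center"
  shows "(\<Sum>S\<in>Pow V. (X + (\<Sum>s\<in>S. x s)) ^ card S * (Y - (\<Sum>s\<in>S. x s)) ^ (n - card S))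
       = (\<Sum>vs\<in>{vs. distinct vs \<and> set vs \<subseteq> V}. (X + Y) ^ (n - length vs) * prod_list (map x vs))"
proof -
  let ?Z = "X + Y"
  let ?a = "\<lambda>S. X + sum x S"
  let ?h = "\<lambda>S U. ?Z ^ (n - card U) * ((-1) ^ card (U - S) * ?a S ^ card U)"
  have expand: "?a S ^ card S * (Y - sum x S) ^ (n - card S) = (\<Sum>T\<in>Pow (V - S). ?h S (S \<union> T))"
    if S: "S \<in> Pow V" for S
  proof -
    have fin: "finite S" "finite (V - S)"
      using S assms(1) by (auto dest: finite_subset)
    then have card: "n - card S = card (V - S)"
      using S assms(2) by (simp add: card_Diff_subset)
    have "?a S ^ card S * (?Z ^ card (V - S - T) * ((-1) ^ card T * ?a S ^ card T)) = ?h S (S \<union> T)"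
      if T: "T \<in> Pow (V - S)" for T
    proof -
      have "finite T" "S \<inter> T = {}" "S \<union> T - S = T"
        using T fin by (auto dest: finite_subset)
      moreover from this have "card (S \<union> T) = card S + card T"
        using fin by (simp add: card_Un_disjoint)
      moreover have "card (V - S - T) = n - (card S + card T)"
        using T \<open>finite T\<close> card by (simp add: card_Diff_subset)
      ultimately show ?thesis
        by (simp only: power_add)
          (intro mult_left_commute2 power_neg_one_mult_commute
            ring_center_commute ring_center_power assms(3))
    qed
    \<comment> \<open>This brings in the central element and makes the base of the second power a
      difference of commuting elements.\<close>
    moreover have "Y - sum x S = ?Z - ?a S"
      by simp
    ultimately show ?thesis
      using fin(2) assms(3) by (simp only: card power_diff_eq_sum_Pow sum_distrib_left cong: sum.cong)
  qed
  have "(\<Sum>S\<in>Pow V. ?a S ^ card S * (Y - sum x S) ^ (n - card S)) =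
      (\<Sum>(S, T)\<in>Sigma (Pow V) (\<lambda>S. Pow (V - S)). ?h S (S \<union> T))"
    using assms(1) by (subst sum.Sigma[symmetric]) (auto intro!: sum.cong expand)
  \<comment> \<open>Disjoint pairs \<open>(S, T)\<close> become pairs \<open>S \<subseteq> U\<close>
    via \<open>U = S \<union> T\<close>, with inverse \<open>T = U - S\<close>.\<close>
  also have "\<dots> = (\<Sum>(U, S)\<in>Sigma (Pow V) Pow. ?h S U)"
    by (rule sum.reindex_bij_witness[of _ "\<lambda>(U, S). (S, U - S)" "\<lambda>(S, T). (S \<union> T, S)"]) auto
  also have "\<dots> = (\<Sum>U\<in>Pow V. ?Z ^ (n - card U) * alternating_power_sum x U X (card U))"
    unfolding alternating_power_sum_def sum_distrib_left
    using assms(1) by (intro sum.Sigma[symmetric]) (auto dest: finite_subset)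
  also have "\<dots> = (\<Sum>U\<in>Pow V. \<Sum>vs\<in>permutations_of_set U.
      ?Z ^ (n - length vs) * prod_list (map x vs))"
    using finite_subset[OF _ assms(1)]
    by (intro sum.cong)
      (auto simp: alternating_power_sum_eq sum_distrib_left length_finite_permutations_of_set
        intro!: sum.cong)
  \<comment> \<open>The union is disjoint, since a list determines \<open>U\<close> as its set of
    entries.\<close>
  also have "\<dots> = (\<Sum>vs\<in>(\<Union>U\<in>Pow V. permutations_of_set U).
      ?Z ^ (n - length vs) * prod_list (map x vs))"
    using assms(1) by (intro sum.UNION_disjoint[symmetric]) (auto dest: permutations_of_setD)
  also have "(\<Union>U\<in>Pow V. permutations_of_set U) = {vs. distinct vs \<and> set vs \<subseteq> V}"
    by (auto simp: permutations_of_set_def)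
  finally show ?thesis .
qed

end
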